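(* Let $\mathbb{P}$ be the polyhedron of feasible points of the STT LP for a tree topology $U$, and let $P\in\mathbb{P}$ be an integer point. If $P$ is induced by some STT $T$, then $P$ is a vertex on the lower envelope of $\mathbb{P}$. Moreover, if the projection $P_D$ of $P$ to the $D$ coordinates is a vertex on the lower envelope of the projection $\mathbb{P}_D$ of $\mathbb{P}$ to the $D$ coordinates, then $P$ is induced by some STT.
   Context: For a tree $U$ and distinct nodes $i,j$, $(i\leftrightsquigarrow j)$ denotes the nodes strictly between $i$ and $j$ on the $U$-path. An STT $T$ over $U$: pick a node $r$ as root; its subtrees are STTs built recursively over the components of $U\setminus\{r\}$. The STT LP for $U$ has variables $D_i$, $X_{ij}$ ($i\ne j$), $Z_{kij}=Z_{kji}$ ($k\in(i\leftrightsquigarrow j)$); constraints $X,Z\ge0$; $X_{ij}+X_{ji}+\sum_{k\in(i\leftrightsquigarrow j)}Z_{kij}\ge1$; $Z_{kij}\le X_{ki}$, $Z_{kij}\le X_{kj}$; $D_i\ge\sum_{j\ne i}X_{ji}$; objectives are of the form minimize $\sum_i w_iD_i$. The point induced by STT $T$ has $X_{ij}=1$ iff $i$ is a proper ancestor of $j$ in $T$, $Z_{kij}=1$ iff $k$ is the lowest common ancestor of $i$ and $j$ in $T$, other $X,Z$ zero, and $D_i=\sum_{j\ne i}X_{ji}$. A vertex of $\mathbb{P}$ (resp. $\mathbb{P}_D$) is on the lower envelope if there is a weight vector $w\in\mathbb{R}^n$ with nonnegative coordinates such that it is the unique minimizer of $\sum_i w_iD_i$ over $\mathbb{P}$ (resp.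 $\mathbb{P}_D$). *)

theory Defs
  imports "HOL-Analysis.Analysis" "HOL-Library.FSet"
begin

text \<open>The node set of the tree topology is all of a finite type \<^typ>\<open>'v\<close>; a graph is its adjacency
  relation.\<close>

definition simple_graph :: "('v \<Rightarrow> 'v \<Rightarrow> bool) \<Rightarrow> bool" where
  "simple_graph E \<longleftrightarrow> symp E \<and> irreflp E"

definition simple_path :: "('v \<Rightarrow> 'v \<Rightarrow> bool) \<Rightarrow> 'v \<Rightarrow> 'v list \<Rightarrow> 'v \<Rightarrow> bool" where
  "simple_path E i p j \<longleftrightarrow>
     p \<noteq> [] \<and> hd p = i \<and> last p = j \<and> distinct p \<and> successively E p"

definition graph_cycle :: "('v \<Rightarrow> 'v \<Rightarrow> bool) \<Rightarrow> 'v list \<Rightarrow> bool" where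
  "graph_cycle E c \<longleftrightarrow>
     length c \<ge> 3 \<and> distinct c \<and> successively E c \<and> E (last c) (hd c)"

definition is_tree :: "('v \<Rightarrow> 'v \<Rightarrow> bool) \<Rightarrow> bool" where
  "is_tree E \<longleftrightarrow>
     simple_graph E \<and> (\<forall>i j. \<exists>p. simple_path E i p j) \<and> \<not> (\<exists>c. graph_cycle E c)"

text \<open>Nodes strictly between \<open>i\<close> and \<open>j\<close>; in a tree the path \<open>p\<close> is unique.\<close>

definition between :: "('v \<Rightarrow> 'v \<Rightarrow> bool) \<Rightarrow> 'v \<Rightarrow> 'v \<Rightarrow> 'v set" where
  "between E i j = {k. \<exists>p. simple_path E i p j \<and> k \<in> set p} - {i, j}"

definition graph_components :: "('v \<Rightarrow> 'v \<Rightarrow> bool) \<Rightarrow> 'v set \<Rightarrow> 'v set set" where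
  "graph_components E S =
     S // {(i, j). i \<in> S \<and> j \<in> S \<and> (\<exists>p. simple_path E i p j \<and> set p \<subseteq> S)}"

datatype (nodes: 'v) rtree = Node 'v "'v rtree fset"

text \<open>\<open>is_stt E C T\<close>: \<open>T\<close> is a search tree over the subgraph induced by \<open>C\<close>. The function \<open>f\<close> assigns
  to each component of \<open>C - {r}\<close> the search tree chosen for it.\<close>

inductive is_stt :: "('v \<Rightarrow> 'v \<Rightarrow> bool) \<Rightarrow> 'v set \<Rightarrow> 'v rtree \<Rightarrow> bool" for E where
  "\<lbrakk>r \<in> C;
    fset ts = f ` graph_components E (C - {r});
    \<And>K. K \<in> graph_components E (C - {r}) \<Longrightarrow> is_stt E K (f K)\<rbrakk>
   \<Longrightarrow> is_stt E C (Node r ts)"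

inductive proper_ancestor :: "'v rtree \<Rightarrow> 'v \<Rightarrow> 'v \<Rightarrow> bool" where
  root: "\<lbrakk>t |\<in>| ts; j \<in> nodes t\<rbrakk> \<Longrightarrow> proper_ancestor (Node r ts) r j"
| sub: "\<lbrakk>t |\<in>| ts; proper_ancestor t i j\<rbrakk> \<Longrightarrow> proper_ancestor (Node r ts) i j"

definition ancestor_eq :: "'v rtree \<Rightarrow> 'v \<Rightarrow> 'v \<Rightarrow> bool" where
  "ancestor_eq T i j \<longleftrightarrow> (i = j \<and> i \<in> nodes T) \<or> proper_ancestor T i j"

definition is_lca :: "'v rtree \<Rightarrow> 'v \<Rightarrow> 'v \<Rightarrow> 'v \<Rightarrow> bool" where
  "is_lca T k i j \<longleftrightarrow>
     ancestor_eq T k i \<and> ancestor_eq T k j \<and>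
     (\<forall>m. ancestor_eq T m i \<and> ancestor_eq T m j \<longrightarrow> ancestor_eq T m k)"

text \<open>A point is a triple \<open>(D, X, Z)\<close> with \<open>D\<^sub>i = D $ i\<close>, \<open>X\<^sub>i\<^sub>j = X $ i $ j\<close> and
  \<open>Z\<^sub>k\<^sub>i\<^sub>j = Z $ k $ i $ j\<close>.  The entries \<open>X $ i $ i\<close> and \<open>Z $ k $ i $ j\<close> with \<open>k\<close> not strictly between
  \<open>i\<close> and \<open>j\<close> are not variables of the LP; they are fixed to \<open>0\<close>, and \<open>Z $ k $ i $ j\<close> and
  \<open>Z $ k $ j $ i\<close> are one variable.\<close>

type_synonym 'v lp_point = "(real ^ 'v) \<times> (real ^ 'v ^ 'v) \<times> (real ^ 'v ^ 'v ^ 'v)"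

definition lp_space :: "('v \<Rightarrow> 'v \<Rightarrow> bool) \<Rightarrow> ('v::finite) lp_point set" where
  "lp_space E = {(D, X, Z).
     (\<forall>i. X $ i $ i = 0) \<and>
     (\<forall>i j k. k \<notin> between E i j \<longrightarrow> Z $ k $ i $ j = 0) \<and>
     (\<forall>i j k. Z $ k $ i $ j = Z $ k $ j $ i)}"

definition stt_polyhedron :: "('v \<Rightarrow> 'v \<Rightarrow> bool) \<Rightarrow> ('v::finite) lp_point set" where
  "stt_polyhedron E = {(D, X, Z). (D, X, Z) \<in> lp_space E \<and>
     (\<forall>i j. i \<noteq> j \<longrightarrow> X $ i $ j \<ge> 0) \<and>
     (\<forall>i j. i \<noteq> j \<longrightarrow> (\<forall>k\<in>between E i j. Z $ k $ i $ j \<ge> 0)) \<and>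
     (\<forall>i j. i \<noteq> j \<longrightarrow> X $ i $ j + X $ j $ i + (\<Sum>k\<in>between E i j. Z $ k $ i $ j) \<ge> 1) \<and>
     (\<forall>i j. i \<noteq> j \<longrightarrow> (\<forall>k\<in>between E i j.
        Z $ k $ i $ j \<le> X $ k $ i \<and> Z $ k $ i $ j \<le> X $ k $ j)) \<and>
     (\<forall>i. D $ i \<ge> (\<Sum>j\<in>UNIV - {i}. X $ j $ i))}"

definition integer_point :: "('v::finite) lp_point \<Rightarrow> bool" where
  "integer_point P \<longleftrightarrow> (case P of (D, X, Z) \<Rightarrow>
     (\<forall>i. D $ i \<in> \<int>) \<and> (\<forall>i j. X $ i $ j \<in> \<int>) \<and> (\<forall>k i j. Z $ k $ i $ j \<in> \<int>))"

definition induced_by :: "('v \<Rightarrow> 'v \<Rightarrow> bool) \<Rightarrow> 'v rtree \<Rightarrow> ('v::finite) lp_point \<Rightarrow> bool" where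
  "induced_by E T P \<longleftrightarrow> (case P of (D, X, Z) \<Rightarrow>
     (D, X, Z) \<in> lp_space E \<and>
     (\<forall>i j. i \<noteq> j \<longrightarrow> X $ i $ j = (if proper_ancestor T i j then 1 else 0)) \<and>
     (\<forall>i j. i \<noteq> j \<longrightarrow> (\<forall>k\<in>between E i j. Z $ k $ i $ j = (if is_lca T k i j then 1 else 0))) \<and>
     (\<forall>i. D $ i = (\<Sum>j\<in>UNIV - {i}. X $ j $ i)))"

text \<open>The parameter \<open>d\<close> extracts the \<open>D\<close> coordinates, so that the same notion applies to the
  polyhedron (\<open>d = fst\<close>) and to its projection (\<open>d = id\<close>). Vertices are extreme points.\<close>

definition lower_envelope_vertex ::
  "('a::real_vector \<Rightarrow> real ^ ('v::finite)) \<Rightarrow> 'a set \<Rightarrow> 'a \<Rightarrow> bool" where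
  "lower_envelope_vertex d S P \<longleftrightarrow> P extreme_point_of S \<and>
     (\<exists>w :: real ^ 'v. (\<forall>i. w $ i \<ge> 0) \<and>
        (\<forall>Q. is_arg_min (\<lambda>q. \<Sum>i\<in>UNIV. w $ i * d q $ i) (\<lambda>q. q \<in> S) Q \<longleftrightarrow> Q = P))"

end

theory Submission
  imports Defs
begin

text \<open>
  For an STT \<open>T\<close>, give every node a weight exceeding the total weight of its proper descendants.
  If \<open>a\<close> is a proper ancestor of \<open>i\<close>, then all nodes between them are descendants of \<open>a\<close>, so the
  constraints give \<open>X\<^sub>a\<^sub>i \<ge> 1 - s\<^sub>a\<close>, where \<open>s\<^sub>a\<close> is the sum of \<open>X\<^sub>d\<^sub>a\<close> over the descendants
  \<open>d\<close> of \<open>a\<close>. What is saved below \<open>a\<close> by a positive \<open>s\<^sub>a\<close> is outweighed by its cost at \<open>a\<close>, so the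
  point induced by \<open>T\<close> is the unique minimizer.

  Conversely, every integer point \<open>P\<close> is dominated in all \<open>D\<close> coordinates by the point of some STT.
  Each connected set \<open>C\<close> has a node \<open>r\<close> such that every other \<open>j\<close> in \<open>C\<close> has some \<open>a\<close> in \<open>C\<close>
  with \<open>X\<^sub>a\<^sub>j \<ge> 1\<close> outside its component of \<open>C - {r}\<close>: otherwise let each \<open>r\<close> point to the
  neighbour in the direction of a violating \<open>j\<close>; two adjacent nodes point to each other, and the
  constraint for their two violating nodes fails. Taking \<open>r\<close> as the root and recursing yields an STT
  whose depths are at most the column sums of \<open>X\<close>. If \<open>P\<^sub>D\<close> is a unique minimizer, it equals the \<open>D\<close>
  part of that STT, and the first part of the theorem identifies \<open>P\<close> itself.
\<close>

section \<open>Simple paths and their uniqueness in acyclic graphs\<close>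

text \<open>Following \<open>p\<close> up to its first node on \<open>q\<close>, and
  \<open>q\<close> from there on, repeats no node.\<close>

lemma simple_path_join:
  assumes p: "simple_path E i p m" and q: "simple_path E m q j"
  shows "\<exists>s. simple_path E i s j \<and> set s \<subseteq> set p \<union> set q"
proof -
  have "\<exists>x\<in>set p. x \<in> set q"
    using p q unfolding simple_path_def by (metis hd_in_set last_in_set)
  then obtain p1 x p2 where p': "p = p1 @ x # p2" "x \<in> set q" "\<forall>y\<in>set p1. y \<notin> set q"
    using split_list_first_prop[of p "\<lambda>x. x \<in> set q"] by blast
  obtain q1 q2 where q': "q = q1 @ x # q2"
    using p'(2) by (metis split_list)
  have "simple_path E i (p1 @ x # q2) j"
    using p q p' q' unfolding simple_path_def
    by (auto simp: successively_append_iff hd_append)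
  then show ?thesis using p' q' by (intro exI[of _ "p1 @ x # q2"]) auto
qed

lemma successively_rev_symp: "symp E \<Longrightarrow> successively E (rev p) = successively E p"
  unfolding successively_rev by (rule successively_cong) (auto dest: sympD)

lemma simple_path_rev:
  assumes "symp E" "simple_path E i p j"
  shows "simple_path E j (rev p) i"
  using assms unfolding simple_path_def
  by (simp add: successively_rev_symp hd_rev last_rev del: successively_rev)

text \<open>Induction on \<open>p\<close>. If the paths leave \<open>i\<close> by different edges,
  the first node \<open>x\<close> of \<open>p'\<close> that lies on \<open>q'\<close> closes a cycle
  through \<open>i\<close>.\<close>

lemma simple_path_unique:
  assumes sym: "symp E" and acyclic: "\<nexists>c. graph_cycle E c"
    and "simple_path E i p j" "simple_path E i q j"
  shows "p = q"
  using assms(3,4)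
proof (induction p arbitrary: i q)
  case Nil
  then show ?case by (simp add: simple_path_def)
next
  case (Cons a p')
  obtain q' where q: "q = i # q'" and a: "a = i"
    using Cons.prems unfolding simple_path_def by (metis list.sel(1) list.exhaust)
  show ?case
  proof (cases "i = j")
    case True
    then have "p' = []" "q' = []"
      using Cons.prems q a unfolding simple_path_def
      by (metis distinct.simps(2) last.simps last_in_set)+
    then show ?thesis using q a by simp
  next
    case False
    then have ne: "p' \<noteq> []" "q' \<noteq> []"
      using Cons.prems q a unfolding simple_path_def by auto
    have pp: "simple_path E (hd p') p' j" "E i (hd p')" "i \<notin> set p'"
      using Cons.prems(1) ne a unfolding simple_path_def by (auto simp: successively_Cons)
    have qq: "simple_path E (hd q') q' j" "E i (hd q')" "i \<notin> set q'"
      using Cons.prems(2) ne q unfolding simple_path_def by (auto simp: successively_Cons)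
    show ?thesis
    proof (cases "hd p' = hd q'")
      case True
      then have "p' = q'" using Cons.IH[OF pp(1), of q'] qq(1) by simp
      then show ?thesis using q a by simp
    next
      case neq: False
      have "\<exists>x\<in>set p'. x \<in> set q'"
        using pp(1) qq(1) unfolding simple_path_def by (metis last_in_set)
      then obtain p1 x p2 where p1: "p' = p1 @ x # p2" "x \<in> set q'" "\<forall>y\<in>set p1. y \<notin> set q'"
        using split_list_first_prop[of p' "\<lambda>x. x \<in> set q'"] by blast
      obtain q1 q2 where q1: "q' = q1 @ x # q2"
        using p1(2) by (metis split_list)
      let ?c = "i # p1 @ x # rev q1"
      \<comment> \<open>If both were empty, \<open>x\<close> would be the head of both
        \<open>p'\<close> and \<open>q'\<close>; one further node brings the cycle to length
        3.\<close>
      have "p1 \<noteq> [] \<or> q1 \<noteq> []" using neq p1 q1 by auto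
      then have "length ?c \<ge> 3" by (cases p1; cases q1) auto
      moreover have "distinct ?c"
        using pp qq p1 q1 unfolding simple_path_def by auto
      moreover have "successively E (p1 @ [x])"
        using pp p1 unfolding simple_path_def by (auto simp: successively_append_iff)
      moreover have "successively E (x # rev q1)"
      proof -
        have "successively E (q1 @ [x])"
          using qq q1 unfolding simple_path_def by (auto simp: successively_append_iff)
        then show ?thesis using successively_rev_symp[OF sym, of "q1 @ [x]"] by (simp del: successively_rev)
      qed
      moreover have "E i (hd (p1 @ [x]))" using pp p1 by (cases p1) auto
      ultimately have "length ?c \<ge> 3" "distinct ?c" "successively E ?c"
        by (auto simp: successively_append_iff successively_Cons hd_append)
      moreover have "E (last ?c) (hd ?c)"
        using qq(2) q1 sym by (cases q1) (auto dest: sympD)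
      ultimately have "graph_cycle E ?c" unfolding graph_cycle_def by blast
      then show ?thesis using acyclic by blast
    qed
  qed
qed

text \<open>The bound \<open>X $ i $ j \<ge> 0\<close> includes the diagonal, whose entries are
  fixed to 0.\<close>

lemma stt_polyhedronD:
  assumes "(D, X, Z) \<in> stt_polyhedron E"
  shows "X $ i $ i = 0" and "X $ i $ j \<ge> 0"
    and "k \<notin> between E i j \<Longrightarrow> Z $ k $ i $ j = 0"
    and "i \<noteq> j \<Longrightarrow> k \<in> between E i j \<Longrightarrow> Z $ k $ i $ j \<ge> 0"
    and "i \<noteq> j \<Longrightarrow> X $ i $ j + X $ j $ i + (\<Sum>k\<in>between E i j. Z $ k $ i $ j) \<ge> 1"
    and "i \<noteq> j \<Longrightarrow> k \<in> between E i j \<Longrightarrow> Z $ k $ i $ j \<le> X $ k $ i"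
    and "i \<noteq> j \<Longrightarrow> k \<in> between E i j \<Longrightarrow> Z $ k $ i $ j \<le> X $ k $ j"
    and "(\<Sum>j\<in>UNIV - {i}. X $ j $ i) \<le> D $ i"
proof -
  note Q = assms[unfolded stt_polyhedron_def lp_space_def mem_Collect_eq prod.case]
  note space = Q[THEN conjunct1] and Q = Q[THEN conjunct2]
  show diag: "X $ i $ i = 0" using space[THEN conjunct1] by blast
  show "X $ i $ j \<ge> 0" using diag Q[THEN conjunct1] by (cases "i = j") auto
  show "Z $ k $ i $ j = 0" if "k \<notin> between E i j"
    using space[THEN conjunct2, THEN conjunct1] that by blast
  note Q = Q[THEN conjunct2]
  show "Z $ k $ i $ j \<ge> 0" if "i \<noteq> j" "k \<in> between E i j"
    using Q[THEN conjunct1] that by blast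
  note Q = Q[THEN conjunct2]
  show "X $ i $ j + X $ j $ i + (\<Sum>k\<in>between E i j. Z $ k $ i $ j) \<ge> 1" if "i \<noteq> j"
    using Q[THEN conjunct1] that by blast
  note Q = Q[THEN conjunct2]
  show "Z $ k $ i $ j \<le> X $ k $ i" "Z $ k $ i $ j \<le> X $ k $ j"
    if "i \<noteq> j" "k \<in> between E i j"
    using Q[THEN conjunct1] that by blast+
  show "(\<Sum>j\<in>UNIV - {i}. X $ j $ i) \<le> D $ i"
    using Q[THEN conjunct2] by blast
qed

section \<open>Segments of a tree\<close>

locale tree_topology =
  fixes U :: "'v::finite \<Rightarrow> 'v \<Rightarrow> bool"
  assumes tree: "is_tree U"
begin

text \<open>The closed version of \<open>between\<close>: with the end points included,
  \<open>seg_triangle\<close> holds without exceptions.\<close>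

definition seg :: "'v \<Rightarrow> 'v \<Rightarrow> 'v set" where
  "seg i j = {k. \<exists>p. simple_path U i p j \<and> k \<in> set p}"

lemma U_sym: "symp U"
  using tree by (simp add: is_tree_def simple_graph_def)

lemma seg_eq_set:
  assumes "simple_path U i p j"
  shows "seg i j = set p"
  using assms simple_path_unique[OF U_sym _ assms] tree
  unfolding seg_def is_tree_def by blast

lemma seg_path:
  obtains p where "simple_path U i p j" "seg i j = set p"
  using tree seg_eq_set unfolding is_tree_def by metis

lemma between_eq_seg: "between U i j = seg i j - {i, j}"
  by (simp add: between_def seg_def)

lemma seg_endpoints [simp]: "i \<in> seg i j" "j \<in> seg i j"
  using seg_path[of i j] unfolding simple_path_def by (metis hd_in_set last_in_set)+

lemma seg_refl [simp]: "seg i i = {i}"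
proof -
  have "simple_path U i [i] i" by (simp add: simple_path_def)
  then show ?thesis using seg_eq_set by fastforce
qed

lemma seg_sym: "seg i j = seg j i"
  by (metis U_sym seg_eq_set seg_path set_rev simple_path_rev)

lemma seg_triangle: "seg i j \<subseteq> seg i m \<union> seg m j"
  by (metis seg_eq_set seg_path simple_path_join)

lemma seg_split:
  assumes "k \<in> seg i j"
  shows "seg i k \<subseteq> seg i j" and "k \<noteq> j \<Longrightarrow> j \<notin> seg i k"
proof -
  obtain p where p: "simple_path U i p j" "seg i j = set p" by (rule seg_path)
  obtain p1 p2 where p1: "p = p1 @ k # p2" using assms p by (metis split_list)
  have "simple_path U i (p1 @ [k]) k"
    using p(1) p1 unfolding simple_path_def by (auto simp: successively_append_iff hd_append)
  then have eq: "seg i k = set (p1 @ [k])" by (rule seg_eq_set)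
  show "seg i k \<subseteq> seg i j" using eq p p1 by auto
  assume "k \<noteq> j"
  then have "j \<in> set p2" using p(1) p1 unfolding simple_path_def
    by (auto split: if_splits)
  then show "j \<notin> seg i k" using eq p(1) p1 unfolding simple_path_def by auto
qed

text \<open>\<open>b\<close> is the second node of the path. Since \<open>r\<close> and
  \<open>b\<close> are adjacent, a path from \<open>a\<close> to \<open>r\<close> that avoids
  \<open>b\<close> extends through \<open>r\<close> to \<open>b\<close>, which gives the last
  property.\<close>

lemma neighbour_towards:
  assumes "r \<noteq> j"
  obtains b where "b \<in> seg r j" "r \<notin> seg b j" "\<And>a. r \<in> seg a b \<or> b \<in> seg a r"
proof -
  obtain p where p: "simple_path U r p j" "seg r j = set p" by (rule seg_path)
  obtain b p' where p': "p = r # b # p'"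
    using p(1) assms unfolding simple_path_def
    by (metis last_ConsL list.exhaust list.sel(1))
  have "simple_path U b (b # p') j" and b: "U r b" "r \<notin> set (b # p')"
    using p(1) p' unfolding simple_path_def by auto
  then have "r \<notin> seg b j" using seg_eq_set by blast
  moreover have "r \<in> seg a b \<or> b \<in> seg a r" for a
  proof -
    obtain q where q: "simple_path U a q r" "seg a r = set q" by (rule seg_path)
    show ?thesis
    proof (cases "b \<in> set q")
      case False
      then have "simple_path U a (q @ [b]) b"
        using q(1) b unfolding simple_path_def
        by (auto simp: successively_append_iff hd_append)
      then have "seg a b = set (q @ [b])" by (rule seg_eq_set)
      then show ?thesis using q by auto
    qed (use q in auto)
  qed
  ultimately show thesis using that p p' by auto
qed

section \<open>Connected sets and components\<close>

text \<open>In a tree these are the connected node sets, the empty one included.\<close>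

definition path_convex :: "'v set \<Rightarrow> bool" where
  "path_convex C \<longleftrightarrow> (\<forall>i\<in>C. \<forall>j\<in>C. seg i j \<subseteq> C)"

text \<open>Paths being unique, a path inside \<open>S\<close> is a segment contained in
  \<open>S\<close>, so components can be handled through \<open>seg\<close> alone.\<close>

lemma components_altdef:
  "graph_components U S = (\<lambda>i. {j. seg i j \<subseteq> S}) ` S"
proof -
  have "(\<exists>p. simple_path U i p j \<and> set p \<subseteq> S) \<longleftrightarrow> seg i j \<subseteq> S" for i j
    by (metis seg_eq_set seg_path)
  then show ?thesis
    unfolding graph_components_def quotient_def using seg_endpoints by fastforce
qed

lemma component_eq:
  assumes "K \<in> graph_components U S" "i \<in> K"
  shows "K = {j. seg i j \<subseteq> S}"
proof -
  obtain h where h: "K = {j. seg h j \<subseteq> S}" using assms by (auto simp: components_altdef)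
  have "seg h j \<subseteq> S \<longleftrightarrow> seg i j \<subseteq> S" for j
    using h assms(2) seg_triangle[of h j i] seg_triangle[of i j h] seg_sym[of h i] by blast
  then show ?thesis using h by auto
qed

lemma component_subset: "K \<in> graph_components U S \<Longrightarrow> K \<subseteq> S"
  using seg_endpoints by (auto simp: components_altdef)

lemma component_nonempty:
  assumes "K \<in> graph_components U S"
  shows "K \<noteq> {}"
proof -
  obtain i where "i \<in> S" "K = {j. seg i j \<subseteq> S}" using assms by (auto simp: components_altdef)
  then have "i \<in> K" by simp
  then show ?thesis by blast
qed

lemma component_path_convex:
  assumes "K \<in> graph_components U S"
  shows "path_convex K"
  unfolding path_convex_def
proof (intro ballI subsetI)
  fix i j k assume ij: "i \<in> K" "j \<in> K" "k \<in> seg i j"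
  then have "seg i k \<subseteq> S" using component_eq[OF assms ij(1)] seg_split(1)[OF ij(3)] by blast
  then show "k \<in> K" using component_eq[OF assms ij(1)] by blast
qed

lemma component_containing:
  assumes "i \<in> S"
  shows "\<exists>K\<in>graph_components U S. i \<in> K"
  using assms by (auto simp: components_altdef intro!: bexI[of _ i])

lemma component_inj:
  "K \<in> graph_components U S \<Longrightarrow> K' \<in> graph_components U S \<Longrightarrow> i \<in> K \<Longrightarrow> i \<in> K' \<Longrightarrow> K = K'"
  using component_eq by blast

section \<open>Ancestors in search trees\<close>

lemma proper_ancestor_nodes:
  "proper_ancestor T i j \<Longrightarrow> i \<in> nodes T \<and> j \<in> nodes T"
  by (induction rule: proper_ancestor.induct) auto

lemma nodes_is_stt: "is_stt U C T \<Longrightarrow> nodes T = C"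
proof (induction rule: is_stt.induct)
  case (1 r C ts f)
  have "nodes (Node r ts) = insert r (\<Union>K\<in>graph_components U (C - {r}). K)"
    using 1 by auto
  also have "\<dots> = C"
    using "1.hyps"(1) component_containing[of _ "C - {r}"] component_subset[of _ "C - {r}"] by blast
  finally show ?case .
qed

lemma proper_ancestor_mem:
  "is_stt U C T \<Longrightarrow> proper_ancestor T i j \<Longrightarrow> i \<in> C \<and> j \<in> C"
  using nodes_is_stt proper_ancestor_nodes by metis

lemma proper_ancestor_Node:
  assumes "fset ts = f ` graph_components U (C - {r})"
    and "\<And>K. K \<in> graph_components U (C - {r}) \<Longrightarrow> is_stt U K (f K)"
  shows "proper_ancestor (Node r ts) i j \<longleftrightarrow>
    (i = r \<and> j \<in> C - {r}) \<or> (\<exists>K\<in>graph_components U (C - {r}). proper_ancestor (f K) i j)"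
    (is "?L \<longleftrightarrow> ?R")
proof
  assume ?L
  then show ?R
  proof cases
    case (root t)
    then obtain K where K: "K \<in> graph_components U (C - {r})" "t = f K" using assms(1) by auto
    then have "j \<in> K" using root assms(2) nodes_is_stt by blast
    then show ?thesis using root component_subset[OF K(1)] by auto
  next
    case (sub t)
    then show ?thesis using assms(1) by auto
  qed
next
  assume ?R
  then show ?L
  proof
    assume ij: "i = r \<and> j \<in> C - {r}"
    then obtain K where K: "K \<in> graph_components U (C - {r})" "j \<in> K"
      using component_containing[of j "C - {r}"] by blast
    then have "j \<in> nodes (f K)" "f K |\<in>| ts"
      using assms(1) nodes_is_stt[OF assms(2)[OF K(1)]] by auto
    then show ?thesis using ij proper_ancestor.root by metis
  next
    assume "\<exists>K\<in>graph_components U (C - {r}). proper_ancestor (f K) i j"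
    then show ?thesis using assms(1) by (auto intro!: proper_ancestor.sub)
  qed
qed

text \<open>Describes the ancestors through components, so that later inductions need not mention
  the members of \<open>ts\<close>.\<close>

lemma is_stt_induct [consumes 1, case_names Node]:
  assumes "is_stt U C T"
    and step: "\<And>r C ts f. \<lbrakk>r \<in> C;
      \<And>K. K \<in> graph_components U (C - {r}) \<Longrightarrow> is_stt U K (f K);
      \<And>i j. proper_ancestor (Node r ts) i j \<longleftrightarrow> (i = r \<and> j \<in> C - {r}) \<or>
        (\<exists>K\<in>graph_components U (C - {r}). proper_ancestor (f K) i j);
      \<And>K. K \<in> graph_components U (C - {r}) \<Longrightarrow> Q K (f K)\<rbrakk> \<Longrightarrow> Q C (Node r ts)"
  shows "Q C T"
  using assms(1)
proof (induction rule: is_stt.induct)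
  case (1 r C ts f)
  show ?case
    by (rule step[of r C f ts])
      (fact "1.hyps"(1,3) "1.IH" | rule proper_ancestor_Node[OF "1.hyps"(2)], fact "1.hyps"(3))+
qed

lemma proper_ancestor_irrefl: "is_stt U C T \<Longrightarrow> \<not> proper_ancestor T i i"
proof (induction rule: is_stt_induct)
  case (Node r C ts f)
  show ?case unfolding Node.hyps(3) using Node.IH by blast
qed

lemma proper_ancestor_trans:
  "is_stt U C T \<Longrightarrow> proper_ancestor T i j \<Longrightarrow> proper_ancestor T j k \<Longrightarrow> proper_ancestor T i k"
proof (induction rule: is_stt_induct)
  case (Node r C ts f)
  note stt = Node.hyps(2) and anc = Node.hyps(3)
  have in_K: "i \<in> K" "j \<in> K" "j \<noteq> r" "j \<in> C"
    if "K \<in> graph_components U (C - {r})" "proper_ancestor (f K) i j" for K i j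
    using proper_ancestor_mem[OF stt[OF that(1)] that(2)] component_subset[OF that(1)] by auto
  from Node.prems(1) consider "i = r" "j \<in> C - {r}"
    | K where "K \<in> graph_components U (C - {r})" "proper_ancestor (f K) i j"
    unfolding anc by blast
  then show ?case
  proof cases
    case 1
    then show ?thesis using \<open>proper_ancestor (Node r ts) j k\<close> in_K unfolding anc by blast
  next
    case (2 K)
    then obtain K' where K': "K' \<in> graph_components U (C - {r})" "proper_ancestor (f K') j k"
      using \<open>proper_ancestor (Node r ts) j k\<close> in_K(3) unfolding anc by blast
    then have "K' = K" using 2 in_K component_inj by metis
    then show ?thesis using 2 K' Node.IH unfolding anc by blast
  qed
qed

text \<open>When \<open>a\<close> is chosen as root, \<open>i\<close> still lies in the same
  connected set, and hence so does the whole path.\<close>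

lemma proper_ancestor_between:
  "is_stt U C T \<Longrightarrow> path_convex C \<Longrightarrow> proper_ancestor T a i \<Longrightarrow> k \<in> between U a i
    \<Longrightarrow> proper_ancestor T a k"
proof (induction rule: is_stt_induct)
  case (Node r C ts f)
  note anc = Node.hyps(3)
  from Node.prems(2) consider "a = r" "i \<in> C - {r}"
    | K where "K \<in> graph_components U (C - {r})" "proper_ancestor (f K) a i"
    unfolding anc by blast
  then show ?case
  proof cases
    case 1
    then have "k \<in> C - {r}"
      using \<open>k \<in> between U a i\<close> \<open>path_convex C\<close> Node.hyps(1)
      unfolding between_eq_seg path_convex_def by blast
    then show ?thesis using 1 unfolding anc by blast
  next
    case (2 K)
    then show ?thesis using Node.IH Node.prems component_path_convex unfolding anc by blast
  qed
qed

text \<open>The first chosen root that is \<open>i\<close>, \<open>j\<close> or a node separating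
  them decides which case holds.\<close>

lemma stt_pair_cases:
  "is_stt U C T \<Longrightarrow> path_convex C \<Longrightarrow> i \<in> C \<Longrightarrow> j \<in> C \<Longrightarrow> i \<noteq> j \<Longrightarrow>
    proper_ancestor T i j \<or> proper_ancestor T j i \<or>
    (\<exists>k\<in>between U i j. proper_ancestor T k i \<and> proper_ancestor T k j)"
proof (induction rule: is_stt_induct)
  case (Node r C ts f)
  note anc = Node.hyps(3)
  show ?case
  proof (cases "i = r \<or> j = r")
    case True
    then show ?thesis using Node.prems unfolding anc by blast
  next
    case False
    then obtain K where K: "K \<in> graph_components U (C - {r})" "i \<in> K"
      using component_containing[of i "C - {r}"] Node.prems(2) by blast
    show ?thesis
    proof (cases "j \<in> K")
      case True
      then show ?thesis
        using Node.IH[OF K(1)] component_path_convex[OF K(1)] K Node.prems(4) unfolding anc by blast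
    next
      case j: False
      then have "r \<in> between U i j"
        using component_eq[OF K] Node.prems(1-3) False unfolding between_eq_seg path_convex_def by blast
      then show ?thesis using False Node.prems(2,3) unfolding anc by blast
    qed
  qed
qed

lemma path_convex_UNIV: "path_convex UNIV"
  by (simp add: path_convex_def)

text \<open>Any common ancestor \<open>m\<close> other than \<open>k\<close> has \<open>k\<close> on
  its path to \<open>i\<close> or to \<open>j\<close>, so it is above \<open>k\<close> by
  \<open>proper_ancestor_between\<close>.\<close>

lemma is_lca_iff:
  assumes T: "is_stt U UNIV T" and k: "k \<in> between U i j"
  shows "is_lca T k i j \<longleftrightarrow> proper_ancestor T k i \<and> proper_ancestor T k j"
proof
  assume "is_lca T k i j"
  then show "proper_ancestor T k i \<and> proper_ancestor T k j"
    using k unfolding is_lca_def ancestor_eq_def between_def by auto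
next
  assume anc: "proper_ancestor T k i \<and> proper_ancestor T k j"
  note nodes = nodes_is_stt[OF T]
  note sub = proper_ancestor_between[OF T path_convex_UNIV]
  have "ancestor_eq T m k" if m: "ancestor_eq T m i" "ancestor_eq T m j" for m
  proof (cases "m = i \<or> m = j")
    case True
    have "i \<noteq> j" using k unfolding between_eq_seg by (cases "i = j") auto
    then have "(m = i \<and> proper_ancestor T i j) \<or> (m = j \<and> proper_ancestor T j i)"
      using True m unfolding ancestor_eq_def by blast
    moreover have "k \<in> between U j i" using k unfolding between_eq_seg seg_sym[of j i] by blast
    ultimately have "proper_ancestor T m k" using sub k by blast
    then show ?thesis by (simp add: ancestor_eq_def)
  next
    case False
    then have "proper_ancestor T m i" "proper_ancestor T m j"
      using m unfolding ancestor_eq_def by auto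
    moreover have "k = m \<or> k \<in> between U m i \<or> k \<in> between U m j"
      using k seg_triangle[of i j m] seg_sym[of i m] unfolding between_eq_seg by blast
    ultimately show ?thesis using sub nodes unfolding ancestor_eq_def by blast
  qed
  then show "is_lca T k i j" using anc unfolding is_lca_def ancestor_eq_def by blast
qed

text \<open>If \<open>i\<close> were above \<open>j\<close>, it would also be above \<open>k\<close>
  on the path, although \<open>k\<close> is above \<open>i\<close>.\<close>

lemma separating_ancestor_incomparable:
  assumes T: "is_stt U UNIV T" and k: "k \<in> between U i j" "proper_ancestor T k i"
  shows "\<not> proper_ancestor T i j"
  using proper_ancestor_between[OF T path_convex_UNIV _ k(1)] k(2)
    proper_ancestor_irrefl[OF T] proper_ancestor_trans[OF T] by blast

lemma between_sym: "between U i j = between U j i"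
  by (auto simp: between_eq_seg seg_sym[of i j])

text \<open>Both nodes are lowest common ancestors, so each is above or equal to the other.\<close>

lemma separating_ancestor_unique:
  assumes T: "is_stt U UNIV T"
    and "k \<in> between U i j" "proper_ancestor T k i" "proper_ancestor T k j"
    and "m \<in> between U i j" "proper_ancestor T m i" "proper_ancestor T m j"
  shows "k = m"
proof -
  have "is_lca T k i j" "is_lca T m i j" using assms is_lca_iff by auto
  then have "ancestor_eq T k m" "ancestor_eq T m k" unfolding is_lca_def by auto
  then show ?thesis
    using proper_ancestor_irrefl[OF T] proper_ancestor_trans[OF T]
    unfolding ancestor_eq_def by blast
qed

section \<open>The point induced by a search tree\<close>

text \<open>Common ancestry replaces \<open>is_lca\<close>; for \<open>k\<close> between
  \<open>i\<close> and \<open>j\<close> the two agree by \<open>is_lca_iff\<close>.\<close>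

definition stt_point :: "'v rtree \<Rightarrow> 'v lp_point" where
  "stt_point T =
    (\<chi> i. real (card {a. proper_ancestor T a i}),
     \<chi> i j. if proper_ancestor T i j then 1 else 0,
     \<chi> k i j. if k \<in> between U i j \<and> proper_ancestor T k i \<and> proper_ancestor T k j then 1 else 0)"

lemma sum_ancestor_indicator:
  assumes T: "is_stt U UNIV T"
  shows "(\<Sum>j\<in>UNIV - {i}. if proper_ancestor T j i then 1 else 0) = real (card {a. proper_ancestor T a i})"
proof -
  have "{j \<in> UNIV - {i}. proper_ancestor T j i} = {a. proper_ancestor T a i}"
    using proper_ancestor_irrefl[OF T] by auto
  then show ?thesis by (simp add: sum.If_cases Int_def)
qed

lemma stt_point_in_lp_space:
  assumes T: "is_stt U UNIV T"
  shows "stt_point T \<in> lp_space U"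
  using proper_ancestor_irrefl[OF T] between_sym
  unfolding stt_point_def lp_space_def by auto

lemma induced_by_iff:
  assumes T: "is_stt U UNIV T"
  shows "induced_by U T P \<longleftrightarrow> P = stt_point T"
proof
  assume "P = stt_point T"
  then show "induced_by U T P"
    using stt_point_in_lp_space[OF T] sum_ancestor_indicator[OF T] is_lca_iff[OF T]
    unfolding induced_by_def stt_point_def by auto
next
  assume ind: "induced_by U T P"
  obtain D X Z where P: "P = (D, X, Z)" by (cases P)
  note ind = ind[unfolded induced_by_def P prod.case lp_space_def mem_Collect_eq]
  have X: "X $ i $ j = (if proper_ancestor T i j then 1 else 0)" for i j
    using ind proper_ancestor_irrefl[OF T] by (cases "i = j") auto
  have Z: "Z $ k $ i $ j =
    (if k \<in> between U i j \<and> proper_ancestor T k i \<and> proper_ancestor T k j then 1 else 0)" for k i j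
  proof (cases "k \<in> between U i j")
    case True
    then have "i \<noteq> j" by (auto simp: between_eq_seg)
    then show ?thesis using ind True is_lca_iff[OF T True] by auto
  qed (use ind in auto)
  have D: "D $ i = real (card {a. proper_ancestor T a i})" for i
    using ind X sum_ancestor_indicator[OF T, of i] by simp
  show "P = stt_point T"
    unfolding P stt_point_def by (simp add: vec_eq_iff D X Z)
qed

text \<open>\<open>stt_pair_cases\<close> yields the covering constraint; the constraint on
  \<open>D\<close> holds with equality.\<close>

lemma stt_point_feasible:
  assumes T: "is_stt U UNIV T"
  shows "stt_point T \<in> stt_polyhedron U"
proof -
  obtain D X Z where P: "stt_point T = (D, X, Z)" by (cases "stt_point T")
  then have X: "X $ i $ j = (if proper_ancestor T i j then 1 else 0)"
    and Z: "Z $ k $ i $ j =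
      (if k \<in> between U i j \<and> proper_ancestor T k i \<and> proper_ancestor T k j then 1 else 0)"
    and D: "D $ i = real (card {a. proper_ancestor T a i})" for i j k
    unfolding stt_point_def by auto
  have "X $ i $ j + X $ j $ i + (\<Sum>k\<in>between U i j. Z $ k $ i $ j) \<ge> 1" if ij: "i \<noteq> j" for i j
  proof -
    have nonneg: "X $ i $ j \<ge> 0" "X $ j $ i \<ge> 0" "(\<Sum>k\<in>between U i j. Z $ k $ i $ j) \<ge> 0"
      by (auto simp: X Z intro!: sum_nonneg)
    from stt_pair_cases[OF T path_convex_UNIV UNIV_I UNIV_I ij]
    consider "X $ i $ j = 1" | "X $ j $ i = 1" | k where "k \<in> between U i j" "Z $ k $ i $ j = 1"
      unfolding X Z by auto
    then show ?thesis
    proof cases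
      case (3 k)
      then have "Z $ k $ i $ j \<le> (\<Sum>k\<in>between U i j. Z $ k $ i $ j)"
        by (intro member_le_sum) (auto simp: Z)
      then show ?thesis using 3 nonneg by linarith
    qed (use nonneg in linarith)+
  qed
  moreover have "(\<Sum>j\<in>UNIV - {i}. X $ j $ i) = D $ i" for i
    unfolding X D by (rule sum_ancestor_indicator[OF T])
  ultimately show ?thesis
    using stt_point_in_lp_space[OF T] unfolding P stt_polyhedron_def by (auto simp: X Z)
qed

section \<open>Search trees of small depth\<close>

text \<open>A node \<open>a\<close> with \<open>r \<in> seg a j\<close> is \<open>r\<close> itself
  or lies in another component of \<open>C - {r}\<close> than \<open>j\<close>. It will pay for the
  level that the root \<open>r\<close> adds above \<open>j\<close>.\<close>

lemma dominating_root:
  assumes conv: "path_convex C" and ne: "C \<noteq> {}"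
    and pair: "\<And>i j. i \<noteq> j \<Longrightarrow> N i j \<or> N j i \<or> (\<exists>k\<in>between U i j. N k i \<and> N k j)"
  shows "\<exists>r\<in>C. \<forall>j\<in>C - {r}. \<exists>a\<in>C. N a j \<and> r \<in> seg a j"
proof (rule ccontr)
  assume neg: "\<not> ?thesis"
  define B where "B r j \<longleftrightarrow> r \<in> C \<and> j \<in> C \<and> j \<noteq> r \<and> (\<forall>a\<in>C. N a j \<longrightarrow> r \<notin> seg a j)" for r j
  \<comment> \<open>A violating pair with smallest \<open>side\<close> replaces the search for two nodes pointing at each other.\<close>
  define side where "side r j = {x \<in> C. r \<notin> seg x j}" for r j
  have ex_B: "\<exists>j. B r j" if "r \<in> C" for r
    using neg that unfolding B_def by blast
  then obtain r0 j0 where "B r0 j0" using ne by blast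
  then obtain r j where B: "B r j"
    and min: "\<And>r' j'. B r' j' \<Longrightarrow> card (side r j) \<le> card (side r' j')"
    using ex_has_least_nat[of "\<lambda>(r, j). B r j" "(r0, j0)" "\<lambda>(r, j). card (side r j)"] by auto
  obtain b where b: "b \<in> seg r j" "r \<notin> seg b j" "\<And>a. r \<in> seg a b \<or> b \<in> seg a r"
    using neighbour_towards[of r j] B unfolding B_def by metis
  have bC: "b \<in> C" using b(1) B conv unfolding B_def path_convex_def by blast
  have rb: "r \<noteq> b" using b(2) by auto
  obtain j' where B': "B b j'" using ex_B[OF bC] by blast
  show False
  proof (cases "b \<in> seg j' r")
    case True
    \<comment> \<open>Here \<open>j'\<close> lies beyond \<open>b\<close> as seen from
      \<open>r\<close>, so moving from \<open>r\<close> to \<open>b\<close> shrinks the side; at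
      least \<open>b\<close> is lost.\<close>
    have "side b j' \<subseteq> side r j"
    proof
      fix x assume x: "x \<in> side b j'"
      have "r \<notin> seg x j"
      proof
        assume "r \<in> seg x j"
        then have "r \<in> seg x b" using seg_triangle[of x j b] b(2) by blast
        then have "b \<notin> seg x r" using seg_split(2) rb by blast
        then show False
          using True x seg_triangle[of j' r x] seg_sym[of j' x] unfolding side_def by blast
      qed
      then show "x \<in> side r j" using x unfolding side_def by blast
    qed
    moreover have "b \<in> side r j" "b \<notin> side b j'" using bC b(2) unfolding side_def by auto
    ultimately have "side b j' \<subset> side r j" by blast
    then have "card (side b j') < card (side r j)" by (intro psubset_card_mono) auto
    then show False using min[OF B'] by simp
  next
    case False
    \<comment> \<open>Here \<open>r\<close> and \<open>b\<close> point at each other: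
      \<open>j\<close> and the nodes of \<open>C\<close> related to it by \<open>N\<close> are on
      the side of \<open>b\<close>, those for \<open>j'\<close> on the side of \<open>r\<close>. No
      node serves both, against \<open>pair\<close>.\<close>
    have right: "r \<notin> seg a b" if "a = j \<or> (a \<in> C \<and> N a j)" for a
      using that B b(2) seg_triangle[of a b j] seg_sym[of b j] unfolding B_def by auto
    have left: "b \<notin> seg a r" if "a = j' \<or> (a \<in> C \<and> N a j')" for a
      using that B' False seg_triangle[of a r j'] unfolding B_def by auto
    have disj: "\<not> ((a = j \<or> (a \<in> C \<and> N a j)) \<and> (a = j' \<or> (a \<in> C \<and> N a j')))" for a
      using left right b(3) by blast
    have "j \<in> C" "j' \<in> C" using B B' unfolding B_def by auto
    moreover from this have "between U j j' \<subseteq> C"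
      using conv unfolding between_eq_seg path_convex_def by blast
    ultimately show False using disj pair[of j j'] by blast
  qed
qed

text \<open>The bound counts only nodes of \<open>C\<close>. In the recursion, the count for a
  component \<open>K\<close> thus omits the node outside \<open>K\<close> that pays for the new
  root.\<close>

lemma shallow_stt:
  assumes pair: "\<And>i j. i \<noteq> j \<Longrightarrow> N i j \<or> N j i \<or> (\<exists>k\<in>between U i j. N k i \<and> N k j)"
    and "path_convex C" "C \<noteq> {}"
  shows "\<exists>T. is_stt U C T \<and> (\<forall>j\<in>C. card {a. proper_ancestor T a j} \<le> card {a \<in> C. N a j})"
  using finite[of C] assms(2,3)
proof (induction C rule: finite_psubset_induct)
  case (psubset C)
  obtain r where r: "r \<in> C" "\<And>j. j \<in> C - {r} \<Longrightarrow> \<exists>a\<in>C. N a j \<and> r \<in> seg a j"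
    using dominating_root[of C N] psubset.prems pair by blast
  let ?comps = "graph_components U (C - {r})"
  have "\<exists>T. is_stt U K T \<and> (\<forall>j\<in>K. card {a. proper_ancestor T a j} \<le> card {a \<in> K. N a j})"
    if K: "K \<in> ?comps" for K
    using psubset.IH[of K] component_subset[OF K] component_path_convex[OF K]
      component_nonempty[OF K] r(1) by blast
  then obtain f where f: "\<And>K. K \<in> ?comps \<Longrightarrow> is_stt U K (f K)"
    "\<And>K j. K \<in> ?comps \<Longrightarrow> j \<in> K \<Longrightarrow> card {a. proper_ancestor (f K) a j} \<le> card {a \<in> K. N a j}"
    by metis
  define ts where "ts = Abs_fset (f ` ?comps)"
  have ts: "fset ts = f ` ?comps" unfolding ts_def by (rule Abs_fset_inverse) simp
  note anc = proper_ancestor_Node[OF ts f(1), simplified]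
  have "is_stt U C (Node r ts)" by (rule is_stt.intros[OF r(1) ts f(1)])
  moreover have "card {a. proper_ancestor (Node r ts) a j} \<le> card {a \<in> C. N a j}" if j: "j \<in> C" for j
  proof (cases "j = r")
    case True
    have "\<not> proper_ancestor (Node r ts) a j" for a
      using True proper_ancestor_mem[OF f(1)] component_subset unfolding anc by blast
    then show ?thesis by simp
  next
    case False
    then obtain K where K: "K \<in> ?comps" "j \<in> K"
      using component_containing[of j "C - {r}"] j by blast
    obtain a where a: "a \<in> C" "N a j" "r \<in> seg a j" using r(2) j False by blast
    have "a \<notin> K" using component_eq[OF K] a(3) seg_sym[of a j] by auto
    have "K' = K" if "K' \<in> ?comps" "proper_ancestor (f K') x j" for K' x
      using component_inj[OF that(1) K(1) _ K(2)] proper_ancestor_mem[OF f(1)[OF that(1)] that(2)] by blast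
    then have "{a. proper_ancestor (Node r ts) a j} \<subseteq> insert r {a. proper_ancestor (f K) a j}"
      unfolding anc by blast
    then have "card {a. proper_ancestor (Node r ts) a j} \<le> card (insert r {a. proper_ancestor (f K) a j})"
      by (intro card_mono) auto
    also have "\<dots> \<le> Suc (card {a. proper_ancestor (f K) a j})" by (simp add: card_insert_if)
    also have "\<dots> \<le> Suc (card {a \<in> K. N a j})" using f(2)[OF K] by simp
    also have "\<dots> = card (insert a {a \<in> K. N a j})" using \<open>a \<notin> K\<close> by simp
    also have "\<dots> \<le> card {a \<in> C. N a j}"
      using a component_subset[OF K(1)] by (intro card_mono) auto
    finally show ?thesis .
  qed
  ultimately show ?case by blast
qed

section \<open>The induced point as unique minimizer\<close>

text \<open>The cost difference is a sum of nonnegative terms. By \<open>le\<close> it is at most 0,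
  so every term vanishes, which fixes \<open>D\<close> and \<open>X\<close>.\<close>

lemma cost_gap:
  fixes w :: "'v \<Rightarrow> real"
  assumes T: "is_stt U UNIV T" and Q: "(D, X, Z) \<in> stt_polyhedron U"
    and w_pos: "\<And>i. w i > 0"
    and w_dom: "\<And>a. (\<Sum>i | proper_ancestor T a i. w i) < w a"
    and le: "(\<Sum>i\<in>UNIV. w i * D $ i) \<le> (\<Sum>i\<in>UNIV. w i * real (card {a. proper_ancestor T a i}))"
  shows "\<And>i. D $ i = real (card {a. proper_ancestor T a i})"
    and "\<And>i j. X $ i $ j = (if proper_ancestor T i j then 1 else 0)"
proof -
  let ?A = "proper_ancestor T"
  note irrefl = proper_ancestor_irrefl[OF T]
  note X_diag = stt_polyhedronD(1)[OF Q] and X_nonneg = stt_polyhedronD(2)[OF Q]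
  define s where "s a = (\<Sum>d | ?A a d. X $ d $ a)" for a
  define rest where "rest i = (\<Sum>j | j \<noteq> i \<and> \<not> ?A j i \<and> \<not> ?A i j. X $ j $ i)" for i
  have s_nonneg: "s a \<ge> 0" and rest_nonneg: "rest a \<ge> 0" for a
    unfolding s_def rest_def by (auto intro!: sum_nonneg X_nonneg)
  \<comment> \<open>\<open>i\<close> and all nodes between \<open>a\<close> and \<open>i\<close> are
    descendants of \<open>a\<close>. Bounding \<open>Z $ k $ a $ i\<close> by
    \<open>X $ k $ a\<close> turns the covering constraint into this inequality.\<close>
  have pair: "X $ a $ i - 1 + s a \<ge> 0" if A: "?A a i" for a i
  proof -
    have ne: "a \<noteq> i" using A irrefl by blast
    have "(\<Sum>k\<in>between U a i. Z $ k $ a $ i) \<le> (\<Sum>k\<in>between U a i. X $ k $ a)"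
      using ne by (intro sum_mono stt_polyhedronD(6)[OF Q]) auto
    moreover have "X $ i $ a + (\<Sum>k\<in>between U a i. X $ k $ a) = (\<Sum>k\<in>insert i (between U a i). X $ k $ a)"
      by (subst sum.insert) (auto simp: between_def)
    moreover have "(\<Sum>k\<in>insert i (between U a i). X $ k $ a) \<le> s a"
      unfolding s_def using A proper_ancestor_between[OF T path_convex_UNIV A]
      by (intro sum_mono2) (auto intro: X_nonneg)
    moreover have "1 \<le> X $ a $ i + X $ i $ a + (\<Sum>k\<in>between U a i. Z $ k $ a $ i)"
      by (rule stt_polyhedronD(5)[OF Q ne])
    ultimately show ?thesis by linarith
  qed
  have split: "(\<Sum>j\<in>UNIV - {i}. X $ j $ i) = (\<Sum>a | ?A a i. X $ a $ i) + s i + rest i" for i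
  proof -
    have "UNIV - {i} = ({a. ?A a i} \<union> {d. ?A i d}) \<union> {j. j \<noteq> i \<and> \<not> ?A j i \<and> \<not> ?A i j}"
      using irrefl by auto
    moreover have "{a. ?A a i} \<inter> {d. ?A i d} = {}"
      using irrefl proper_ancestor_trans[OF T] by blast
    ultimately show ?thesis
      unfolding s_def rest_def by (simp add: sum.union_disjoint Int_Un_distrib2 disjoint_iff)
  qed
  \<comment> \<open>The gap to the cost of \<open>T\<close> is the sum of all \<open>g1 i + g2 i + g3 i + g4 i\<close>.\<close>
  define g1 where "g1 i = w i * (D $ i - (\<Sum>j\<in>UNIV - {i}. X $ j $ i))" for i
  define g2 where "g2 i = w i * (\<Sum>a | ?A a i. X $ a $ i - 1 + s a)" for i
  define g3 where "g3 i = w i * rest i" for i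
  define g4 where "g4 i = s i * (w i - (\<Sum>j | ?A i j. w j))" for i
  have nonneg: "g1 i \<ge> 0" "g2 i \<ge> 0" "g3 i \<ge> 0" "g4 i \<ge> 0" for i
  proof -
    show "g1 i \<ge> 0" unfolding g1_def using stt_polyhedronD(8)[OF Q] w_pos[of i] by (intro mult_nonneg_nonneg) auto
    show "g2 i \<ge> 0" unfolding g2_def using pair w_pos[of i]
      by (intro mult_nonneg_nonneg sum_nonneg) auto
    show "g3 i \<ge> 0" unfolding g3_def using w_pos[of i] rest_nonneg by (intro mult_nonneg_nonneg) auto
    show "g4 i \<ge> 0" unfolding g4_def using w_dom[of i] s_nonneg by (intro mult_nonneg_nonneg) auto
  qed
  \<comment> \<open>Double counting of ancestor pairs: the terms \<open>s a\<close> added in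
    \<open>g2\<close> cancel against the amount subtracted in \<open>g4\<close>.\<close>
  have swap: "(\<Sum>i\<in>UNIV. w i * (\<Sum>a | ?A a i. s a)) = (\<Sum>i\<in>UNIV. s i * (\<Sum>j | ?A i j. w j))"
    using sum.swap_restrict[of UNIV UNIV "\<lambda>i a. w i * s a" "\<lambda>i a. ?A a i"]
    by (simp add: sum_distrib_left mult.commute)
  have "(\<Sum>i\<in>UNIV. g1 i + g2 i + g3 i + g4 i) =
    (\<Sum>i\<in>UNIV. w i * D $ i) - (\<Sum>i\<in>UNIV. w i * real (card {a. ?A a i}))
    + (\<Sum>i\<in>UNIV. w i * (\<Sum>a | ?A a i. s a)) - (\<Sum>i\<in>UNIV. s i * (\<Sum>j | ?A i j. w j))"
    unfolding sum.distrib[symmetric] sum_subtractf[symmetric]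
    by (rule sum.cong)
      (simp_all add: g1_def g2_def g3_def g4_def split sum.distrib sum_subtractf algebra_simps)
  then have "(\<Sum>i\<in>UNIV. g1 i + g2 i + g3 i + g4 i) \<le> 0" using swap le by simp
  moreover have gs: "g1 i + g2 i + g3 i + g4 i \<ge> 0" for i using nonneg[of i] by linarith
  ultimately have "(\<Sum>i\<in>UNIV. g1 i + g2 i + g3 i + g4 i) = 0"
    by (intro antisym sum_nonneg) auto
  then have "g1 i + g2 i + g3 i + g4 i = 0" for i
    using sum_nonneg_eq_0_iff[of UNIV "\<lambda>i. g1 i + g2 i + g3 i + g4 i"] gs by simp
  then have zero: "g1 i = 0" "g2 i = 0" "g3 i = 0" "g4 i = 0" for i
    using nonneg[of i] by (metis add_nonneg_eq_0_iff add_nonneg_nonneg)+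
  \<comment> \<open>\<open>w_dom\<close> is strict, so \<open>g4 i = 0\<close> forces
    \<open>s i = 0\<close>.\<close>
  have s0: "s i = 0" and rest0: "rest i = 0" for i
    using zero[of i] w_pos[of i] w_dom[of i] unfolding g3_def g4_def by auto
  have "X $ a $ i = 1" if "?A a i" for a i
  proof -
    have "(\<Sum>a | ?A a i. X $ a $ i - 1 + s a) = 0"
      using zero(2)[of i] w_pos[of i] unfolding g2_def by auto
    then have "\<forall>a\<in>{a. ?A a i}. X $ a $ i - 1 + s a = 0"
      using pair by (subst (asm) sum_nonneg_eq_0_iff) auto
    then show ?thesis using that s0 by simp
  qed
  moreover have "X $ j $ i = 0" if "?A i j" for i j
    using s0[of i] that unfolding s_def by (subst (asm) sum_nonneg_eq_0_iff) (auto simp: X_nonneg)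
  moreover have "X $ j $ i = 0" if "j \<noteq> i" "\<not> ?A j i" "\<not> ?A i j" for i j
    using rest0[of i] that unfolding rest_def by (subst (asm) sum_nonneg_eq_0_iff) (auto simp: X_nonneg)
  ultimately show X: "X $ i $ j = (if ?A i j then 1 else 0)" for i j
    using X_diag irrefl by (cases "i = j") metis+
  show "D $ i = real (card {a. ?A a i})" for i
    using zero(1)[of i] w_pos[of i] sum_ancestor_indicator[OF T, of i] unfolding g1_def X by simp
qed

text \<open>\<open>Z $ k $ i $ j\<close> is bounded by two entries of \<open>X\<close>, hence 0
  unless \<open>k\<close> is a common ancestor. At most one such \<open>k\<close> is between
  \<open>i\<close> and \<open>j\<close>, and then \<open>X\<close> contributes nothing to the
  covering constraint, so that \<open>Z\<close> entry is 1.\<close>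

lemma stt_point_eqI:
  assumes T: "is_stt U UNIV T" and Q: "(D, X, Z) \<in> stt_polyhedron U"
    and D: "\<And>i. D $ i = real (card {a. proper_ancestor T a i})"
    and X: "\<And>i j. X $ i $ j = (if proper_ancestor T i j then 1 else 0)"
  shows "(D, X, Z) = stt_point T"
proof -
  let ?A = "proper_ancestor T"
  have Z0: "Z $ k $ i $ j = 0" if "\<not> (k \<in> between U i j \<and> ?A k i \<and> ?A k j)" for k i j
  proof (cases "k \<in> between U i j")
    case True
    then have "i \<noteq> j" by (auto simp: between_eq_seg)
    then have "0 \<le> Z $ k $ i $ j" "Z $ k $ i $ j \<le> X $ k $ i" "Z $ k $ i $ j \<le> X $ k $ j"
      using stt_polyhedronD(4,6,7)[OF Q _ True] by auto
    then show ?thesis using that True unfolding X by (auto split: if_splits)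
  qed (rule stt_polyhedronD(3)[OF Q])
  have Z1: "Z $ k $ i $ j = 1" if k: "k \<in> between U i j" "?A k i" "?A k j" for k i j
  proof -
    have ne: "i \<noteq> j" using k by (auto simp: between_eq_seg)
    have "X $ i $ j = 0" "X $ j $ i = 0"
      using separating_ancestor_incomparable[OF T] k between_sym[of i j] unfolding X by auto
    moreover have "(\<Sum>m\<in>between U i j. Z $ m $ i $ j) = (\<Sum>m\<in>{k}. Z $ m $ i $ j)"
    proof (rule sum.mono_neutral_right)
      show "\<forall>m\<in>between U i j - {k}. Z $ m $ i $ j = 0"
        using Z0 separating_ancestor_unique[OF T k] by blast
    qed (use k in auto)
    moreover have "1 \<le> X $ i $ j + X $ j $ i + (\<Sum>m\<in>between U i j. Z $ m $ i $ j)"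
      "Z $ k $ i $ j \<le> X $ k $ i"
      by (rule stt_polyhedronD(5)[OF Q ne], rule stt_polyhedronD(6)[OF Q ne k(1)])
    ultimately show ?thesis using k(2) unfolding X by auto
  qed
  show ?thesis unfolding stt_point_def using Z0 Z1 by (auto simp: vec_eq_iff D X)
qed

text \<open>The weight of \<open>a\<close> is \<open>?n ^ c a\<close>, with \<open>c a\<close> the
  number of its descendants. There are \<open>c a < ?n\<close> terms, each at most
  \<open>?n ^ (c a - 1)\<close>.\<close>

lemma descendant_dominating_weights:
  assumes T: "is_stt U UNIV T"
  obtains w :: "'v \<Rightarrow> real" where "\<And>i. w i > 0" "\<And>a. (\<Sum>i | proper_ancestor T a i. w i) < w a"
proof
  let ?A = "proper_ancestor T" and ?n = "real CARD('v)"
  define c where "c a = card {i. ?A a i}" for a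
  have n: "?n \<ge> 1" using zero_less_card_finite[where 'a = 'v] by linarith
  show "?n ^ c i > 0" for i using n by simp
  show "(\<Sum>i | ?A a i. ?n ^ c i) < ?n ^ c a" for a
  \<comment> \<open>For a leaf, \<open>c a - 1\<close> truncates to 0 and
    \<open>?n * ?n ^ (c a - 1)\<close> need not equal \<open>?n ^ c a\<close>.\<close>
  proof (cases "{i. ?A a i} = {}")
    case True
    then show ?thesis using n by simp
  next
    case False
    then have "c a > 0" unfolding c_def by (simp add: card_gt_0_iff)
    have "?n ^ c i \<le> ?n ^ (c a - 1)" if "?A a i" for i
    proof -
      have "{j. ?A i j} \<subset> {j. ?A a j}"
        using that proper_ancestor_trans[OF T] proper_ancestor_irrefl[OF T] by blast
      then have "c i < c a" unfolding c_def by (intro psubset_card_mono) auto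
      then show ?thesis using n by (intro power_increasing) auto
    qed
    then have "(\<Sum>i | ?A a i. ?n ^ c i) \<le> real (c a) * ?n ^ (c a - 1)"
      unfolding c_def by (intro sum_bounded_above) auto
    also have "real (c a) < ?n"
    proof -
      have "{i. ?A a i} \<subset> UNIV" using proper_ancestor_irrefl[OF T] by blast
      then show ?thesis unfolding c_def using psubset_card_mono[of "UNIV :: 'v set"] by simp
    qed
    then have "real (c a) * ?n ^ (c a - 1) < ?n * ?n ^ (c a - 1)"
      using n by (intro mult_strict_right_mono) auto
    also have "\<dots> = ?n ^ c a" using \<open>c a > 0\<close> by (simp add: power_eq_if)
    finally show ?thesis .
  qed
qed

text \<open>This form also identifies a feasible point of which only the \<open>D\<close> part is
  known to agree with that of \<open>stt_point T\<close>.\<close>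

lemma stt_point_unique_minimizer:
  assumes T: "is_stt U UNIV T"
  obtains w :: "real ^ 'v" where "\<And>i. w $ i \<ge> 0"
    "\<And>Q. Q \<in> stt_polyhedron U \<Longrightarrow>
      (\<Sum>i\<in>UNIV. w $ i * fst Q $ i) \<le> (\<Sum>i\<in>UNIV. w $ i * fst (stt_point T) $ i) \<Longrightarrow> Q = stt_point T"
proof -
  obtain w :: "'v \<Rightarrow> real" where w: "\<And>i. w i > 0" "\<And>a. (\<Sum>i | proper_ancestor T a i. w i) < w a"
    using descendant_dominating_weights[OF T] by blast
  show thesis
  proof (rule that[of "\<chi> i. w i"])
    show "(\<chi> i. w i) $ i \<ge> 0" for i using w(1)[of i] by simp
    fix Q :: "'v lp_point"
    assume Q: "Q \<in> stt_polyhedron U"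
      and le: "(\<Sum>i\<in>UNIV. (\<chi> i. w i) $ i * fst Q $ i) \<le> (\<Sum>i\<in>UNIV. (\<chi> i. w i) $ i * fst (stt_point T) $ i)"
    obtain D X Z where DXZ: "Q = (D, X, Z)" by (cases Q)
    have le': "(\<Sum>i\<in>UNIV. w i * D $ i) \<le> (\<Sum>i\<in>UNIV. w i * real (card {a. proper_ancestor T a i}))"
      using le unfolding DXZ stt_point_def by simp
    show "Q = stt_point T"
      unfolding DXZ using cost_gap[OF T _ w le'] Q stt_point_eqI[OF T] unfolding DXZ by blast
  qed
qed

section \<open>Integer points\<close>

text \<open>An integer below 1 is at most 0. If all cases failed, the left side of the covering
  constraint would be at most 0.\<close>

lemma integer_point_pair:
  assumes Q: "(D, X, Z) \<in> stt_polyhedron U" and int: "integer_point (D, X, Z)" and ne: "i \<noteq> j"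
  shows "X $ i $ j \<ge> 1 \<or> X $ j $ i \<ge> 1 \<or> (\<exists>k\<in>between U i j. X $ k $ i \<ge> 1 \<and> X $ k $ j \<ge> 1)"
proof (rule ccontr)
  assume neg: "\<not> ?thesis"
  have le0: "x \<le> 0" if "x \<in> \<int>" "\<not> x \<ge> 1" for x :: real
    using that by (auto elim!: Ints_cases)
  have "X $ i $ j \<le> 0" "X $ j $ i \<le> 0"
    using neg int le0 unfolding integer_point_def by auto
  moreover have "Z $ k $ i $ j \<le> 0" if k: "k \<in> between U i j" for k
  proof -
    have "Z $ k $ i $ j \<le> X $ k $ i" "Z $ k $ i $ j \<le> X $ k $ j"
      by (rule stt_polyhedronD(6,7)[OF Q ne k])+
    then have "\<not> Z $ k $ i $ j \<ge> 1" using neg k by force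
    then show ?thesis using int le0 unfolding integer_point_def by auto
  qed
  then have "(\<Sum>k\<in>between U i j. Z $ k $ i $ j) \<le> 0" by (rule sum_nonpos)
  moreover have "1 \<le> X $ i $ j + X $ j $ i + (\<Sum>k\<in>between U i j. Z $ k $ i $ j)"
    by (rule stt_polyhedronD(5)[OF Q ne])
  ultimately show False by linarith
qed

lemma integer_point_dominated:
  assumes P: "P \<in> stt_polyhedron U" and int: "integer_point P"
  obtains T where "is_stt U UNIV T" "\<And>i. fst (stt_point T) $ i \<le> fst P $ i"
proof -
  obtain D X Z where DXZ: "P = (D, X, Z)" by (cases P)
  \<comment> \<open>Integer entries may exceed 1, hence a threshold; the column sums of
    \<open>X\<close> still bound the number of related nodes.\<close>
  define N where "N i j \<longleftrightarrow> X $ i $ j \<ge> 1" for i j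
  have "\<exists>T. is_stt U UNIV T \<and> (\<forall>j\<in>UNIV. card {a. proper_ancestor T a j} \<le> card {a \<in> UNIV. N a j})"
    using integer_point_pair[OF P[unfolded DXZ] int[unfolded DXZ]]
    by (intro shallow_stt path_convex_UNIV) (auto simp: N_def)
  then obtain T where T: "is_stt U UNIV T"
    and depth: "\<And>j. card {a. proper_ancestor T a j} \<le> card {a. N a j}" by auto
  note Q = stt_polyhedronD[OF P[unfolded DXZ]]
  have "fst (stt_point T) $ j \<le> D $ j" for j
  proof -
    have "\<not> N j j" using Q(1) unfolding N_def by simp
    then have sub: "{a. N a j} \<subseteq> UNIV - {j}" by auto
    have "real (card {a. N a j}) = (\<Sum>a | N a j. 1)" by simp
    also have "\<dots> \<le> (\<Sum>a | N a j. X $ a $ j)" by (intro sum_mono) (auto simp: N_def)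
    also have "\<dots> \<le> (\<Sum>a\<in>UNIV - {j}. X $ a $ j)" using sub Q(2) by (intro sum_mono2) auto
    also have "\<dots> \<le> D $ j" by (rule Q(8))
    finally show ?thesis using depth[of j] unfolding stt_point_def by simp
  qed
  then show thesis using that T DXZ by simp
qed

end

section \<open>Unique minimizers as vertices\<close>

text \<open>The cost is affine along a segment. If \<open>P\<close> were in its interior, both ends,
  costing at least as much as \<open>P\<close>, would cost the same and so equal
  \<open>P\<close>.\<close>

lemma lower_envelope_vertexI:
  fixes w :: "real ^ 'v::finite"
  assumes "linear d" "P \<in> S" "\<And>i. w $ i \<ge> 0"
    and unique: "\<And>Q. Q \<in> S \<Longrightarrow> (\<Sum>i\<in>UNIV. w $ i * d Q $ i) \<le> (\<Sum>i\<in>UNIV. w $ i * d P $ i) \<Longrightarrow> Q = P"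
  shows "lower_envelope_vertex d S P"
proof -
  define c where "c q = (\<Sum>i\<in>UNIV. w $ i * d q $ i)" for q
  have c_comb: "c ((1 - u) *\<^sub>R a + u *\<^sub>R b) = (1 - u) * c a + u * c b" for u a b
    unfolding c_def linear_add[OF \<open>linear d\<close>] linear_scale[OF \<open>linear d\<close>]
    by (simp add: sum.distrib sum_distrib_left sum_subtractf algebra_simps)
  have unique': "Q = P" if "Q \<in> S" "c Q \<le> c P" for Q
    using unique that unfolding c_def by blast
  have "P \<notin> open_segment a b" if ab: "a \<in> S" "b \<in> S" for a b
  proof
    assume "P \<in> open_segment a b"
    then obtain u where u: "a \<noteq> b" "0 < u" "u < 1" "P = (1 - u) *\<^sub>R a + u *\<^sub>R b"
      unfolding in_segment by blast
    have cP: "c P = (1 - u) * c a + u * c b" using c_comb u(4) by simp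
    have "c P \<le> c a" "c P \<le> c b" using unique' ab by (metis linorder_le_cases)+
    then have "(1 - u) * (c a - c P) \<ge> 0" "u * (c b - c P) \<ge> 0" using u(2,3) by auto
    moreover have "(1 - u) * (c a - c P) + u * (c b - c P) = 0"
      unfolding right_diff_distrib using cP by (simp add: left_diff_distrib)
    ultimately have "(1 - u) * (c a - c P) = 0" "u * (c b - c P) = 0" by linarith+
    then have "c a = c P" "c b = c P" using u(2,3) by auto
    then show False using unique' ab u(1) by (metis order_refl)
  qed
  then have "P extreme_point_of S" using \<open>P \<in> S\<close> unfolding extreme_point_of_def by blast
  moreover have "is_arg_min c (\<lambda>q. q \<in> S) Q \<longleftrightarrow> Q = P" for Q
    using unique' \<open>P \<in> S\<close> unfolding is_arg_min_def by (metis linorder_not_le order_less_le)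
  ultimately show ?thesis
    unfolding lower_envelope_vertex_def c_def using assms(3) by blast
qed

theorem theorem3p6:
  fixes U :: "'v::finite \<Rightarrow> 'v \<Rightarrow> bool" and P :: "'v lp_point"
  assumes "is_tree U"
    and "P \<in> stt_polyhedron U"
    and "integer_point P"
  shows "((\<exists>T. is_stt U UNIV T \<and> induced_by U T P) \<longrightarrow>
            lower_envelope_vertex fst (stt_polyhedron U) P) \<and>
         (lower_envelope_vertex id (fst ` stt_polyhedron U) (fst P) \<longrightarrow>
            (\<exists>T. is_stt U UNIV T \<and> induced_by U T P))"
proof (intro conjI impI)
  interpret tree_topology U by standard (rule assms(1))
  assume "\<exists>T. is_stt U UNIV T \<and> induced_by U T P"
  then obtain T where T: "is_stt U UNIV T" "P = stt_point T" using induced_by_iff by blast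
  obtain w :: "real ^ 'v" where "\<And>i. w $ i \<ge> 0"
    "\<And>Q. Q \<in> stt_polyhedron U \<Longrightarrow>
      (\<Sum>i\<in>UNIV. w $ i * fst Q $ i) \<le> (\<Sum>i\<in>UNIV. w $ i * fst P $ i) \<Longrightarrow> Q = P"
    using stt_point_unique_minimizer[OF T(1)] T(2) by blast
  then show "lower_envelope_vertex fst (stt_polyhedron U) P"
    using lower_envelope_vertexI[OF linear_fst assms(2)] by blast
next
  interpret tree_topology U by standard (rule assms(1))
  assume "lower_envelope_vertex id (fst ` stt_polyhedron U) (fst P)"
  then obtain w :: "real ^ 'v" where w: "\<And>i. w $ i \<ge> 0"
    and min: "\<And>Q. is_arg_min (\<lambda>q. \<Sum>i\<in>UNIV. w $ i * q $ i) (\<lambda>q. q \<in> fst ` stt_polyhedron U) Q \<longleftrightarrow> Q = fst P"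
    unfolding lower_envelope_vertex_def by auto
  obtain T where T: "is_stt U UNIV T" and dom: "\<And>i. fst (stt_point T) $ i \<le> fst P $ i"
    using integer_point_dominated[OF assms(2,3)] by blast
  \<comment> \<open>Nonnegative weights carry coordinatewise domination over to the cost.\<close>
  have "(\<Sum>i\<in>UNIV. w $ i * fst (stt_point T) $ i) \<le> (\<Sum>i\<in>UNIV. w $ i * fst P $ i)"
    using w dom by (intro sum_mono mult_left_mono)
  then have "is_arg_min (\<lambda>q. \<Sum>i\<in>UNIV. w $ i * q $ i) (\<lambda>q. q \<in> fst ` stt_polyhedron U) (fst (stt_point T))"
    using min[of "fst P"] stt_point_feasible[OF T] unfolding is_arg_min_def by fastforce
  then have D_eq: "fst P = fst (stt_point T)" using min by simp
  \<comment> \<open>Minimality for \<open>w\<close> concerns only the projection; weights adapted to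
    \<open>T\<close> determine \<open>X\<close> and \<open>Z\<close> as well.\<close>
  obtain w' :: "real ^ 'v" where "\<And>Q. Q \<in> stt_polyhedron U \<Longrightarrow>
      (\<Sum>i\<in>UNIV. w' $ i * fst Q $ i) \<le> (\<Sum>i\<in>UNIV. w' $ i * fst (stt_point T) $ i) \<Longrightarrow> Q = stt_point T"
    using stt_point_unique_minimizer[OF T] by blast
  then have "P = stt_point T" using assms(2) D_eq by simp
  then show "\<exists>T. is_stt U UNIV T \<and> induced_by U T P" using T induced_by_iff by blast
qed

end
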